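(* For every finite abstract simplicial complex $G$, as well as for every product $G=G_1\times G_2\times\cdots\times G_k$ of finite abstract simplicial complexes, one has $\Theta(\psi(G))=f_0(G)$, where $\Theta$ denotes the Shannon capacity.
   Context: A finite abstract simplicial complex $G$ is a finite set of finite non-empty sets closed under taking non-empty subsets; an element $x\in G$ has dimension $|x|-1$. The connection graph $\psi(G)$ is the finite simple graph with vertex set $G$ in which distinct $a,b$ are adjacent iff $a\cap b\neq\emptyset$. $f_0(G)$ is the number of $0$-dimensional sets in $G$. For a product $G=G_1\times\cdots\times G_k$ (Cartesian product of sets), $\psi(G)=\psi(G_1)\cdots\psi(G_k)$ is the strong product of the connection graphs, i.e. distinct $(a_1,\dots,a_k)$, $(b_1,\dots,b_k)$ are adjacent iff $a_j\cap b_j\neq\emptyset$ for all $j$, and $f_0(G)$ is the number of elements $(x_1,\dots,x_k)$ with every $x_j$ of dimension $0$. The strong product of graphs $(V,E)$ and $(W,F)$ has vertex set $V\times W$, with distinct $(a,b)$, $(c,d)$ adjacent iff ($a=c$ or $(a,c)\in E$) and ($b=d$ or $(b,d)\in F$). The independence number $i(A)$ of a graph is the maximal cardinality of a set of pairwise non-adjacent vertices. The Shannon capacity is $\Theta(A)=\lim_{n\to\infty} i(A^n)^{1/n}$, where $A^n$ is the $n$-fold strong product of $A$ with itself. *)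

theory Defs
  imports Complex_Main "Graph_Theory.Pair_Digraph"
begin

section \<open>Finite abstract simplicial complexes\<close>

definition abstract_simplicial_complex :: "'a set set \<Rightarrow> bool" where
  "abstract_simplicial_complex G \<longleftrightarrow>
     finite G \<and> (\<forall>x\<in>G. finite x \<and> x \<noteq> {}) \<and> (\<forall>x\<in>G. \<forall>y. y \<noteq> {} \<and> y \<subseteq> x \<longrightarrow> y \<in> G)"

definition simplex_dim :: "'a set \<Rightarrow> int" where
  "simplex_dim x = int (card x) - 1"

definition f0 :: "'a set set \<Rightarrow> nat" where
  "f0 G = card {x \<in> G. simplex_dim x = 0}"

text \<open>An element of a product of complexes is a list \<open>[x1, \<dots>, xk]\<close>, and
  \<open>listset [G1, \<dots>, Gk]\<close> is the set of those with \<open>xj \<in> Gj\<close> for all \<open>j\<close>.\<close>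

definition f0_product :: "'a set set list \<Rightarrow> nat" where
  "f0_product Gs = card {xs \<in> listset Gs. \<forall>x\<in>set xs. simplex_dim x = 0}"

section \<open>Strong products, independence number, Shannon capacity\<close>

text \<open>A simple graph is a \<open>pair_graph\<close>: a finite vertex set with a symmetric irreflexive set of
  arcs, each undirected edge being represented by its two orientations.\<close>

definition strong_product ::
    "'a pair_pre_digraph \<Rightarrow> 'b pair_pre_digraph \<Rightarrow> ('a \<times> 'b) pair_pre_digraph" where
  "strong_product A B =
     \<lparr> pverts = pverts A \<times> pverts B,
       parcs = {((a, b), (c, d)) | a b c d.
                  (a, b) \<in> pverts A \<times> pverts B \<and> (c, d) \<in> pverts A \<times> pverts B \<and>
                  (a, b) \<noteq> (c, d) \<and>
                  (a = c \<or> (a, c) \<in> parcs A) \<and> (b = d \<or> (b, d) \<in> parcs B)} \<rparr>"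

definition relabel_graph :: "('a \<Rightarrow> 'b) \<Rightarrow> 'a pair_pre_digraph \<Rightarrow> 'b pair_pre_digraph" where
  "relabel_graph f A = \<lparr> pverts = f ` pverts A, parcs = map_prod f f ` parcs A \<rparr>"

text \<open>Iterated strong product, with the nested pair \<open>(x1, (x2, \<dots>))\<close> written as the list
  \<open>[x1, x2, \<dots>]\<close> so that all numbers of factors share one vertex type. The empty product is the
  one-vertex graph, the unit of the strong product.\<close>

primrec strong_product_list :: "'a pair_pre_digraph list \<Rightarrow> 'a list pair_pre_digraph" where
  "strong_product_list [] = \<lparr> pverts = {[]}, parcs = {} \<rparr>"
| "strong_product_list (A # As) =
     relabel_graph (\<lambda>(x, xs). x # xs) (strong_product A (strong_product_list As))"

definition strong_power :: "'a pair_pre_digraph \<Rightarrow> nat \<Rightarrow> 'a list pair_pre_digraph" where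
  "strong_power A n = strong_product_list (replicate n A)"

definition independent_set :: "'a pair_pre_digraph \<Rightarrow> 'a set \<Rightarrow> bool" where
  "independent_set A S \<longleftrightarrow>
     S \<subseteq> pverts A \<and> (\<forall>a\<in>S. \<forall>b\<in>S. a \<noteq> b \<longrightarrow> (a, b) \<notin> parcs A)"

definition independence_number :: "'a pair_pre_digraph \<Rightarrow> nat" where
  "independence_number A = Max (card ` {S. independent_set A S})"

definition shannon_seq :: "'a pair_pre_digraph \<Rightarrow> nat \<Rightarrow> real" where
  "shannon_seq A n = root n (real (independence_number (strong_power A n)))"

text \<open>\<open>lim\<close> is only meaningful for convergent sequences, so a statement about \<open>shannon_capacity A\<close>
  has to be accompanied by \<open>convergent (shannon_seq A)\<close>.\<close>

definition shannon_capacity :: "'a pair_pre_digraph \<Rightarrow> real" where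
  "shannon_capacity A = lim (shannon_seq A)"

section \<open>Connection graphs\<close>

definition connection_graph :: "'a set set \<Rightarrow> 'a set pair_pre_digraph" where
  "connection_graph G =
     \<lparr> pverts = G, parcs = {(a, b). a \<in> G \<and> b \<in> G \<and> a \<noteq> b \<and> a \<inter> b \<noteq> {}} \<rparr>"

definition connection_graph_product :: "'a set set list \<Rightarrow> 'a set list pair_pre_digraph" where
  "connection_graph_product Gs = strong_product_list (map connection_graph Gs)"

section \<open>Consistency checks\<close>

lemma pverts_strong_product_list: "pverts (strong_product_list As) = listset (map pverts As)"
  by (induction As) (auto simp: relabel_graph_def strong_product_def set_Cons_def image_iff)

lemma parcs_strong_product_list:
  "(xs, ys) \<in> parcs (strong_product_list As) \<longleftrightarrow>
     xs \<in> listset (map pverts As) \<and> ys \<in> listset (map pverts As) \<and> xs \<noteq> ys \<and>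
     (\<forall>j<length As. xs ! j = ys ! j \<or> (xs ! j, ys ! j) \<in> parcs (As ! j))"
proof (induction As arbitrary: xs ys)
  case Nil
  then show ?case by auto
next
  case (Cons A As)
  let ?V = "listset (map pverts As)"
  have *: "(b = d \<or> (b, d) \<in> parcs (strong_product_list As)) \<longleftrightarrow>
      (\<forall>j<length As. b ! j = d ! j \<or> (b ! j, d ! j) \<in> parcs (As ! j))"
    if "b \<in> ?V" "d \<in> ?V" for b d
    using that Cons.IH[of b d] by auto
  show ?case
  proof (cases "xs = [] \<or> ys = []")
    case True
    then show ?thesis
      by (auto simp: relabel_graph_def strong_product_def set_Cons_def)
  next
    case False
    then obtain a b c d where [simp]: "xs = a # b" "ys = c # d"
      by (meson neq_Nil_conv)
    have "(xs, ys) \<in> parcs (strong_product_list (A # As)) \<longleftrightarrow>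
        a \<in> pverts A \<and> c \<in> pverts A \<and> b \<in> ?V \<and> d \<in> ?V \<and> (a, b) \<noteq> (c, d) \<and>
        (a = c \<or> (a, c) \<in> parcs A) \<and> (b = d \<or> (b, d) \<in> parcs (strong_product_list As))"
      by (simp add: relabel_graph_def strong_product_def pverts_strong_product_list image_iff
          Bex_def) blast
    then show ?thesis
      using *[of b d] by (auto simp: set_Cons_def All_less_Suc2)
  qed
qed

lemma listset_conv_nth: "xs \<in> listset As \<longleftrightarrow> length xs = length As \<and> (\<forall>j<length As. xs ! j \<in> As ! j)"
  by (induction As arbitrary: xs) (auto simp: set_Cons_def All_less_Suc2 length_Suc_conv)

lemma pverts_connection_graph_product: "pverts (connection_graph_product Gs) = listset Gs"
  by (simp add: connection_graph_product_def pverts_strong_product_list connection_graph_def comp_def)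

lemma parcs_connection_graph_product:
  assumes "\<forall>G\<in>set Gs. abstract_simplicial_complex G"
  shows "(as, bs) \<in> parcs (connection_graph_product Gs) \<longleftrightarrow>
     as \<in> listset Gs \<and> bs \<in> listset Gs \<and> as \<noteq> bs \<and> (\<forall>j<length Gs. as ! j \<inter> bs ! j \<noteq> {})"
proof -
  have ne: "x \<noteq> {}" if "x \<in> Gs ! j" "j < length Gs" for x j
    using assms that nth_mem unfolding abstract_simplicial_complex_def by metis
  have eq: "map (pverts \<circ> connection_graph) Gs = Gs"
    by (simp add: connection_graph_def comp_def)
  have step: "(as ! j = bs ! j \<or> (as ! j, bs ! j) \<in> parcs (map connection_graph Gs ! j)) \<longleftrightarrow>
      as ! j \<inter> bs ! j \<noteq> {}"
    if "as \<in> listset Gs" "bs \<in> listset Gs" "j < length Gs" for j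
  proof -
    have "as ! j \<in> Gs ! j" "bs ! j \<in> Gs ! j"
      using that by (simp_all add: listset_conv_nth)
    moreover have "as ! j \<noteq> {}"
      using ne \<open>as ! j \<in> Gs ! j\<close> that(3) by blast
    ultimately show ?thesis
      using that(3) by (cases "as ! j = bs ! j") (simp_all add: connection_graph_def)
  qed
  show ?thesis
    unfolding connection_graph_product_def parcs_strong_product_list map_map eq length_map
    using step by (cases "as \<in> listset Gs \<and> bs \<in> listset Gs") (simp, simp only: de_Morgan_conj, metis)
qed

lemma pair_graph_connection_graph:
  assumes "abstract_simplicial_complex G"
  shows "pair_graph (connection_graph G)"
proof
  show "symmetric (connection_graph G)"
    by (auto simp: symmetric_def connection_graph_def intro!: symI)
  have "parcs (connection_graph G) \<subseteq> G \<times> G"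
    by (auto simp: connection_graph_def)
  then show "finite (parcs (connection_graph G))"
    using assms by (meson abstract_simplicial_complex_def finite_SigmaI finite_subset)
next
  show "finite (pverts (connection_graph G))"
    using assms by (simp add: connection_graph_def abstract_simplicial_complex_def)
qed (auto simp: connection_graph_def)

end

theory Submission
  imports Defs
begin

text \<open>The vertex set of a connection graph is covered by cliques that are indexed by an independent
  set. The singletons \<open>{v}\<close> in \<open>G\<close> are pairwise disjoint, hence independent, and there are \<open>f0 G\<close>
  of them. On the other hand, choose a vertex \<open>v \<in> x\<close> of every simplex \<open>x\<close> and send \<open>x\<close> to \<open>{v}\<close>:
  simplices with the same image share a point, so every fibre of this map is a clique, and an
  independent set meets each fibre at most once. Hence \<open>f0 G\<close> is the independence number.

  Such a clique cover is multiplicative (\<open>clique_transversal_strong_product\<close>): in a strong product,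
  products of cliques are cliques and products of independent sets are independent. All powers of the
  graph therefore inherit a cover of the same kind (\<open>clique_transversal_strong_product_list\<close>), the
  independence number of the \<open>n\<close>-th power is exactly the \<open>n\<close>-th power of the size of the index set,
  and the sequence defining the Shannon capacity is constant from \<open>n = 1\<close> on
  (\<open>shannon_capacity_clique_transversal\<close>). A product of connection graphs has a cover for the same
  reason, which gives the statement for products of complexes.\<close>

text \<open>The cliques of the cover are given as the fibres of a map \<open>r\<close> into \<open>Z\<close>, so that covers of the
  factors combine to a cover of the strong product by applying the maps componentwise.\<close>

definition clique_transversal :: "'a pair_pre_digraph \<Rightarrow> 'a set \<Rightarrow> bool" where
  "clique_transversal A Z \<longleftrightarrow>
     independent_set A Z \<and>
     (\<exists>r. r ` pverts A \<subseteq> Z \<and>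
          (\<forall>a\<in>pverts A. \<forall>b\<in>pverts A. r a = r b \<longrightarrow> a = b \<or> (a, b) \<in> parcs A))"

text \<open>An independent set contains at most one vertex of each clique, so the cover maps it
  injectively into \<open>Z\<close>.\<close>

lemma independence_number_clique_transversal:
  assumes "clique_transversal A Z" "finite Z"
  shows "independence_number A = card Z"
proof -
  obtain r where r: "r ` pverts A \<subseteq> Z"
      "\<And>a b. a \<in> pverts A \<Longrightarrow> b \<in> pverts A \<Longrightarrow> r a = r b \<Longrightarrow> a = b \<or> (a, b) \<in> parcs A"
    using assms(1) unfolding clique_transversal_def by blast
  have le: "card S \<le> card Z" if "independent_set A S" for S
  proof (rule card_inj_on_le)
    show "inj_on r S"
      using that r(2) unfolding inj_on_def independent_set_def by blast
    show "r ` S \<subseteq> Z"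
      using that r(1) unfolding independent_set_def by blast
  qed (rule assms(2))
  show ?thesis
    unfolding independence_number_def
  proof (rule Max_eqI)
    show "finite (card ` {S. independent_set A S})"
      by (rule finite_subset[of _ "{..card Z}"]) (use le in auto)
    show "card Z \<in> card ` {S. independent_set A S}"
      using assms(1) unfolding clique_transversal_def by blast
  qed (use le in auto)
qed

lemma clique_transversal_strong_product:
  assumes "clique_transversal A Z" "clique_transversal B W"
  shows "clique_transversal (strong_product A B) (Z \<times> W)"
proof -
  obtain r where r: "r ` pverts A \<subseteq> Z"
      "\<forall>a\<in>pverts A. \<forall>b\<in>pverts A. r a = r b \<longrightarrow> a = b \<or> (a, b) \<in> parcs A"
    using assms(1) unfolding clique_transversal_def by blast
  obtain s where s: "s ` pverts B \<subseteq> W"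
      "\<forall>a\<in>pverts B. \<forall>b\<in>pverts B. s a = s b \<longrightarrow> a = b \<or> (a, b) \<in> parcs B"
    using assms(2) unfolding clique_transversal_def by blast
  have "independent_set (strong_product A B) (Z \<times> W)"
    using assms unfolding clique_transversal_def independent_set_def strong_product_def by auto
  moreover have "map_prod r s ` pverts (strong_product A B) \<subseteq> Z \<times> W"
    using r(1) s(1) by (auto simp: strong_product_def)
  moreover have "p = q \<or> (p, q) \<in> parcs (strong_product A B)"
    if "p \<in> pverts (strong_product A B)" "q \<in> pverts (strong_product A B)"
      "map_prod r s p = map_prod r s q" for p q
  proof -
    obtain a b c d where pq: "p = (a, b)" "q = (c, d)"
      by (meson surj_pair)
    have "a \<in> pverts A" "b \<in> pverts B" "c \<in> pverts A" "d \<in> pverts B" "r a = r c" "s b = s d"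
      using that by (simp_all add: pq strong_product_def)
    moreover from this have "a = c \<or> (a, c) \<in> parcs A" "b = d \<or> (b, d) \<in> parcs B"
      using r(2) s(2) by blast+
    ultimately show ?thesis
      by (simp add: pq strong_product_def)
  qed
  ultimately show ?thesis
    unfolding clique_transversal_def by blast
qed

text \<open>Needed because the iterated strong product turns nested pairs into lists.\<close>

lemma clique_transversal_relabel_graph:
  assumes "inj f" "clique_transversal A Z"
  shows "clique_transversal (relabel_graph f A) (f ` Z)"
proof -
  obtain r where r: "r ` pverts A \<subseteq> Z"
      "\<forall>a\<in>pverts A. \<forall>b\<in>pverts A. r a = r b \<longrightarrow> a = b \<or> (a, b) \<in> parcs A"
    using assms(2) unfolding clique_transversal_def by blast
  have arcs: "(f a, f b) \<in> parcs (relabel_graph f A) \<longleftrightarrow> (a, b) \<in> parcs A" for a b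
    using assms(1) by (auto simp: relabel_graph_def inj_eq)
  have verts: "pverts (relabel_graph f A) = f ` pverts A"
    by (simp add: relabel_graph_def)
  have "independent_set (relabel_graph f A) (f ` Z)"
    using assms(2) unfolding clique_transversal_def independent_set_def by (auto simp: verts arcs)
  moreover have "(f \<circ> r \<circ> inv f) ` pverts (relabel_graph f A) \<subseteq> f ` Z"
    using r(1) assms(1) by (auto simp: verts)
  moreover have "f a = f b \<or> (f a, f b) \<in> parcs (relabel_graph f A)"
    if "a \<in> pverts A" "b \<in> pverts A" "(f \<circ> r \<circ> inv f) (f a) = (f \<circ> r \<circ> inv f) (f b)" for a b
  proof -
    have "r a = r b"
      using that(3) assms(1) by (simp add: inj_eq)
    then show ?thesis
      using r(2) that(1,2) unfolding arcs by blast
  qed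
  ultimately show ?thesis
    unfolding clique_transversal_def verts by (intro conjI exI[of _ "f \<circ> r \<circ> inv f"]) blast+
qed

lemma clique_transversal_strong_product_list:
  "list_all2 clique_transversal As Zs \<Longrightarrow>
   clique_transversal (strong_product_list As) (listset Zs)"
proof (induction rule: list_all2_induct)
  case Nil
  show ?case
    by (auto simp: clique_transversal_def independent_set_def)
next
  case (Cons A As Z Zs)
  let ?f = "\<lambda>(x, xs). x # xs"
  have "inj ?f"
    by (auto simp: inj_def)
  moreover have "listset (Z # Zs) = ?f ` (Z \<times> listset Zs)"
    by (auto simp: set_Cons_def)
  moreover have "clique_transversal (strong_product A (strong_product_list As)) (Z \<times> listset Zs)"
    using Cons by (intro clique_transversal_strong_product)
  ultimately show ?case
    using clique_transversal_relabel_graph by (metis strong_product_list.simps(2))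
qed

lemma finite_listset: "\<forall>Z\<in>set Zs. finite Z \<Longrightarrow> finite (listset Zs)"
  by (induction Zs) (auto simp: set_Cons_def intro!: finite_image_set2)

lemma card_listset_replicate: "card (listset (replicate n Z)) = card Z ^ n"
proof (induction n)
  case (Suc n)
  have "listset (replicate (Suc n) Z) = (\<lambda>(x, xs). x # xs) ` (Z \<times> listset (replicate n Z))"
    by (auto simp: set_Cons_def)
  moreover have "inj_on (\<lambda>(x, xs). x # xs) (Z \<times> listset (replicate n Z))"
    by (auto simp: inj_on_def)
  ultimately show ?case
    using Suc by (simp add: card_image card_cartesian_product)
qed simp

lemma shannon_capacity_clique_transversal:
  assumes "clique_transversal A Z" "finite Z"
  shows "convergent (shannon_seq A) \<and> shannon_capacity A = real (card Z)"
proof -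
  \<comment> \<open>The index \<open>0\<close> is exceptional because \<open>root 0\<close> is constantly \<open>0\<close>.\<close>
  have "shannon_seq A n = real (card Z)" if "n \<ge> 1" for n
  proof -
    have "clique_transversal (strong_power A n) (listset (replicate n Z))"
      unfolding strong_power_def using assms(1)
      by (intro clique_transversal_strong_product_list) (simp add: list_all2_conv_all_nth)
    moreover have "finite (listset (replicate n Z))"
      using assms(2) by (intro finite_listset) simp
    ultimately have "independence_number (strong_power A n) = card Z ^ n"
      by (simp add: independence_number_clique_transversal card_listset_replicate)
    then show ?thesis
      using that by (simp add: shannon_seq_def real_root_power_cancel)
  qed
  then have "shannon_seq A \<longlonglongrightarrow> real (card Z)"
    by (intro tendsto_eventually eventually_sequentiallyI)
  then show ?thesis
    unfolding shannon_capacity_def by (auto simp: convergent_def limI)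
qed

lemma simplex_dim_eq_0_iff: "simplex_dim x = 0 \<longleftrightarrow> (\<exists>v. x = {v})"
  unfolding simplex_dim_def by (auto simp: card_1_singleton_iff)

text \<open>The map sends a simplex to the singleton of a chosen vertex of it, so two simplices in one
  fibre intersect in that vertex. The singleton belongs to \<open>G\<close> because \<open>G\<close> is closed under taking
  nonempty subsets.\<close>

lemma clique_transversal_connection_graph:
  assumes "abstract_simplicial_complex G"
  shows "clique_transversal (connection_graph G) {x \<in> G. simplex_dim x = 0}"
proof -
  let ?r = "\<lambda>x. {SOME v. v \<in> x}"
  have some: "(SOME v. v \<in> x) \<in> x" if "x \<in> G" for x
    using that assms by (auto simp: abstract_simplicial_complex_def some_in_eq)
  have "independent_set (connection_graph G) {x \<in> G. simplex_dim x = 0}"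
    by (auto simp: independent_set_def connection_graph_def simplex_dim_eq_0_iff)
  moreover have "?r x \<in> G" if "x \<in> G" for x
    using that some[OF that] assms unfolding abstract_simplicial_complex_def by blast
  then have "?r ` pverts (connection_graph G) \<subseteq> {x \<in> G. simplex_dim x = 0}"
    by (auto simp: connection_graph_def simplex_dim_eq_0_iff)
  moreover have "x = y \<or> (x, y) \<in> parcs (connection_graph G)"
    if "x \<in> G" "y \<in> G" "?r x = ?r y" for x y
    using that some[of x] some[of y] by (auto simp: connection_graph_def)
  ultimately show ?thesis
    unfolding clique_transversal_def
    by (intro conjI exI[of _ ?r]) (auto simp: connection_graph_def)
qed

lemma listset_map_filter:
  "listset (map (\<lambda>G. {x \<in> G. P x}) Gs) = {xs \<in> listset Gs. \<forall>x\<in>set xs. P x}"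
  by (induction Gs) (auto simp: set_Cons_def)

lemma clique_transversal_connection_graph_product:
  assumes "\<forall>G\<in>set Gs. abstract_simplicial_complex G"
  shows "clique_transversal (connection_graph_product Gs)
           {xs \<in> listset Gs. \<forall>x\<in>set xs. simplex_dim x = 0}"
  unfolding connection_graph_product_def listset_map_filter[symmetric]
  by (intro clique_transversal_strong_product_list)
    (simp add: list_all2_conv_all_nth assms clique_transversal_connection_graph)

theorem theorem5:
  shows "(\<forall>G :: 'a set set. abstract_simplicial_complex G \<longrightarrow>
            convergent (shannon_seq (connection_graph G)) \<and>
            shannon_capacity (connection_graph G) = real (f0 G)) \<and>
         (\<forall>Gs :: 'a set set list. Gs \<noteq> [] \<and> (\<forall>G\<in>set Gs. abstract_simplicial_complex G) \<longrightarrow>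
            convergent (shannon_seq (connection_graph_product Gs)) \<and>
            shannon_capacity (connection_graph_product Gs) = real (f0_product Gs))"
proof (intro conjI[of "\<forall>G. _ G"] allI impI)
  fix G :: "'a set set"
  assume G: "abstract_simplicial_complex G"
  then have "finite {x \<in> G. simplex_dim x = 0}"
    by (simp add: abstract_simplicial_complex_def)
  then show "convergent (shannon_seq (connection_graph G)) \<and>
      shannon_capacity (connection_graph G) = real (f0 G)"
    unfolding f0_def
    by (intro shannon_capacity_clique_transversal clique_transversal_connection_graph G)
next
  fix Gs :: "'a set set list"
  assume Gs: "Gs \<noteq> [] \<and> (\<forall>G\<in>set Gs. abstract_simplicial_complex G)"
  then have "finite {xs \<in> listset Gs. \<forall>x\<in>set xs. simplex_dim x = 0}"
    using finite_listset[of Gs] by (simp add: abstract_simplicial_complex_def)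
  then show "convergent (shannon_seq (connection_graph_product Gs)) \<and>
      shannon_capacity (connection_graph_product Gs) = real (f0_product Gs)"
    unfolding f0_product_def using Gs
    by (intro shannon_capacity_clique_transversal clique_transversal_connection_graph_product) auto
qed

end
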